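(* Let $r>1$ be real, let $k_r\in(0,1)$ be the singular modulus, $k'_r=\sqrt{1-k_r^2}$, and let $a(r)$ be the elliptic alpha function. For $n\ge0$ let $$B^{(3)}_n=\sum_{j=0}^{n}\left[\binom nj\left(\tfrac12\right)_j\left(\tfrac12\right)_{n-j}\right]^3,$$ and put $$b(r)=\frac{3a(r)+\sqrt r-6a(r)k_r^2-9\sqrt r k_r^2+12\sqrt r k_r^4}{\sqrt r(1-2k_r^2)^2},\qquad c(r)=\frac{3a(r)^2-6a(r)\sqrt r k_r^2-rk_r^2+4rk_r^4}{r(1-2k_r^2)^2}.$$ Then $$\sum_{n=0}^{\infty}\frac{B^{(3)}_n}{(n!)^3}(2k_rk'_r)^{2n}\left(n^2+(b(r)-1)n+c(r)\right)=\frac{3}{(1-2k_r^2)^2\,r\,\pi^2}.$$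
   Context: $K(x)=\int_0^{\pi/2}\frac{dt}{\sqrt{1-x^2\sin^2 t}}$ and $E(x)=\int_0^{\pi/2}\sqrt{1-x^2\sin^2 t}\,dt$. For $r>0$ the singular modulus $k_r\in(0,1)$ is the unique solution $w$ of $K(\sqrt{1-w^2})/K(w)=\sqrt r$. The elliptic alpha function is $a(r)=\frac{\pi}{4K(k_r)^2}-\sqrt r\left(\frac{E(k_r)}{K(k_r)}-1\right)$. $(a)_n=a(a+1)\cdots(a+n-1)$, $(a)_0=1$. *)

theory Defs
  imports "HOL-Analysis.Analysis"
begin

definition ellK :: "real \<Rightarrow> real" where
  "ellK x = integral {0..pi/2} (\<lambda>t. 1 / sqrt (1 - x^2 * (sin t)^2))"

definition ellE :: "real \<Rightarrow> real" where
  "ellE x = integral {0..pi/2} (\<lambda>t. sqrt (1 - x^2 * (sin t)^2))"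

definition singular_modulus :: "real \<Rightarrow> real" where
  "singular_modulus r = (THE w. 0 < w \<and> w < 1 \<and> ellK (sqrt (1 - w^2)) / ellK w = sqrt r)"

definition elliptic_alpha :: "real \<Rightarrow> real" where
  "elliptic_alpha r = (let k = singular_modulus r in
     pi / (4 * (ellK k)^2) - sqrt r * (ellE k / ellK k - 1))"

definition B3 :: "nat \<Rightarrow> real" where
  "B3 n = (\<Sum>j=0..n. (real (n choose j) * pochhammer (1/2) j * pochhammer (1/2) (n - j)) ^ 3)"

end

(* The generating function of B3 n / n!^3 is the square of 3F2(1/2,1/2,1/2;1,1;z). Clausen's formula
   and a quadratic transformation turn it into (2K/pi)^4 at z = (2 k k')^2, provided that
   k^2 < 1/2, which is where r > 1 enters. The weights n and n^2 correspond to the operator z d/dz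
   applied once and twice; the derivatives of K and E express the sum as a polynomial in K and E, and
   substituting E/K from the definition of the alpha function leaves only the constant. *)

theory Submission
  imports Defs
begin

section \<open>Coefficient ratios\<close>

text \<open>Clausen's formula is an identity of formal power series, because the square of
  2F1(1/4,1/4;1;z) satisfies the third order equation whose recurrence defines the 3F2. The
  quadratic transformation must be proved for functions. The map x -> 4x(1-x) is invariant under x
  -> 1-x while K is not, so the formula for z = 4x(1-x) with x = k^2 is confined to the branch x <
  1/2.

  A second obstacle is that k_r is a definite description: nothing can be said about it before
  K(sqrt(1-w^2))/K(w) is known to take the value sqrt r exactly once. Monotonicity and continuity of
  K come from its power series, and the large values of the quotient from a logarithmic lower bound
  for K near modulus 1. The quotient is strictly decreasing and equals 1 at w = 1/sqrt 2, so r > 1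
  places k_r to the left of that point.

  The shape of b(r) and c(r) comes from cancellation: the sum is a quadratic polynomial in p = pi/(4
  sqrt r K^2), in which b removes the linear term and c the constant term.\<close>

definition pochhammer_ratio :: "real \<Rightarrow> nat \<Rightarrow> real" where
  "pochhammer_ratio a n = pochhammer a n / fact n"

lemma pochhammer_ratio_0 [simp]: "pochhammer_ratio a 0 = 1"
  by (simp add: pochhammer_ratio_def)

lemma pochhammer_ratio_Suc:
  "pochhammer_ratio a (Suc n) * real (Suc n) = (a + real n) * pochhammer_ratio a n"
  by (simp add: pochhammer_ratio_def pochhammer_Suc del: of_nat_Suc)

lemma pochhammer_ratio_Suc':
  "pochhammer_ratio a (Suc n) = (a + real n) * pochhammer_ratio a n / real (Suc n)"
  using pochhammer_ratio_Suc[of a n] by (simp add: field_simps)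

text \<open>Used at a = -1/2, where it relates the coefficients of E to those of K.\<close>

lemma pochhammer_ratio_plus_one:
  "a * pochhammer_ratio (a + 1) n = (a + real n) * pochhammer_ratio a n"
proof -
  have "a * pochhammer (a + 1) n = (a + real n) * pochhammer a n"
    using pochhammer_rec[of a n] pochhammer_Suc[of a n] by (simp add: mult.commute)
  then show ?thesis
    by (simp add: pochhammer_ratio_def)
qed

text \<open>Consecutive ratios are (a+n)/(n+1), of absolute value at most 1. The bound yields radius
  of convergence at least 1 and the geometric majorant for termwise integration.\<close>

lemma abs_pochhammer_ratio_le_1:
  assumes "\<bar>a\<bar> \<le> 1"
  shows "\<bar>pochhammer_ratio a n\<bar> \<le> 1"
proof (induction n)
  case (Suc n)
  have "\<bar>a + real n\<bar> * \<bar>pochhammer_ratio a n\<bar> \<le> real (Suc n) * 1"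
    by (intro mult_mono Suc) (use assms in auto)
  then show ?case
    unfolding pochhammer_ratio_Suc' abs_divide abs_mult by (simp add: divide_le_eq)
qed simp

lemma pochhammer_ratio_pos: "a > 0 \<Longrightarrow> pochhammer_ratio a n > 0"
  by (simp add: pochhammer_ratio_def pochhammer_pos)

lemma pochhammer_ratio_sums:
  assumes "\<bar>y\<bar> < 1"
  shows "(\<lambda>n. pochhammer_ratio a n * y ^ n) sums ((1 - y) powr (- a))"
proof -
  have "(\<lambda>n. ((- a) gchoose n) * (- y) ^ n) sums ((1 + (- y)) powr (- a))"
    by (rule gen_binomial_real) (use assms in simp)
  moreover have "((- a) gchoose n) * (- y) ^ n = pochhammer_ratio a n * y ^ n" for n
  proof -
    have "(- 1) ^ n * (- y) ^ n = y ^ n"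
      by (simp flip: power_mult_distrib)
    then show ?thesis
      by (simp add: gbinomial_pochhammer pochhammer_ratio_def mult_ac)
  qed
  ultimately show ?thesis by simp
qed

section \<open>Hypergeometric power series\<close>

lemma fps_conv_radius_ge_1:
  fixes F :: "real fps"
  assumes "\<And>n. \<bar>fps_nth F n\<bar> \<le> 1"
  shows "fps_conv_radius F \<ge> 1"
  unfolding fps_conv_radius_def
proof (rule conv_radius_geI_ex)
  fix r :: real assume r: "0 < r" "ereal r < 1"
  have "summable (\<lambda>n. fps_nth F n * r ^ n)"
  proof (rule summable_comparison_test')
    show "summable (\<lambda>n. r ^ n)" using r by (simp add: summable_geometric)
    show "norm (fps_nth F n * r ^ n) \<le> r ^ n" for n
      using mult_right_mono[OF assms, of "r ^ n" n] r by (simp add: abs_mult)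
  qed
  then show "\<exists>z. norm z = r \<and> summable (\<lambda>n. fps_nth F n * z ^ n)"
    using r by (intro exI[of _ r]) simp
qed

lemma less_fps_conv_radius:
  fixes x :: real
  assumes "fps_conv_radius F \<ge> 1" "\<bar>x\<bar> < 1"
  shows "ereal (norm x) < fps_conv_radius F"
proof -
  have "ereal (norm x) < 1" using assms(2) by simp
  then show ?thesis using assms(1) by (rule less_le_trans)
qed

text \<open>The Euler operator x d/dx. It is a derivation that multiplies the n-th coefficient by n,
  so a hypergeometric recurrence and its differential equation become the same identity of
  series.\<close>

definition fps_theta :: "real fps \<Rightarrow> real fps" where
  "fps_theta F = fps_X * fps_deriv F"

lemma fps_theta_nth [simp]: "fps_nth (fps_theta F) n = real n * fps_nth F n"
  by (cases n) (simp_all add: fps_theta_def)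

lemma fps_theta_mult: "fps_theta (F * G) = fps_theta F * G + F * fps_theta G"
  by (simp add: fps_theta_def algebra_simps)

lemma fps_theta_add: "fps_theta (F + G) = fps_theta F + fps_theta G"
  by (simp add: fps_theta_def algebra_simps)

lemma fps_theta_X: "fps_theta fps_X = fps_X"
  by (simp add: fps_theta_def)

lemma fps_theta_const [simp]: "fps_theta (fps_const c) = 0"
  by (simp add: fps_theta_def)

lemma fps_theta_numeral [simp]: "fps_theta (numeral m) = 0"
  by (simp add: fps_theta_def)

lemma fps_conv_radius_theta:
  assumes "fps_conv_radius F \<ge> 1"
  shows "fps_conv_radius (fps_theta F) \<ge> 1"
proof -
  have "fps_conv_radius (fps_deriv F) \<ge> 1"
    using assms fps_conv_radius_deriv[of F] by (rule order_trans)
  then have "min (fps_conv_radius fps_X) (fps_conv_radius (fps_deriv F)) \<ge> 1"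
    by simp
  then show ?thesis
    unfolding fps_theta_def using fps_conv_radius_mult order_trans by blast
qed

lemma eval_fps_theta:
  assumes "fps_conv_radius F \<ge> 1" "\<bar>x\<bar> < 1"
  shows "eval_fps (fps_theta F) x = x * eval_fps (fps_deriv F) x"
proof -
  have "fps_conv_radius (fps_deriv F) \<ge> 1"
    using assms(1) fps_conv_radius_deriv[of F] by (rule order_trans)
  then show ?thesis
    unfolding fps_theta_def using assms less_fps_conv_radius[of "fps_deriv F" x]
    by (subst eval_fps_mult) auto
qed

text \<open>The series \<open>2F1(a,a;1;x)\<close>, \<open>3F2(1/2,1/2,1/2;1,1;x)\<close> and, for \<open>a = 1/2\<close> and \<open>a = -1/2\<close>,
  \<open>2K/\<pi>\<close> and \<open>2E/\<pi>\<close> in the variable \<open>x = k^2\<close>.\<close>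

definition fps_2F1 :: "real \<Rightarrow> real fps" where
  "fps_2F1 a = Abs_fps (\<lambda>n. pochhammer_ratio a n ^ 2)"

definition fps_3F2 :: "real fps" where
  "fps_3F2 = Abs_fps (\<lambda>n. pochhammer_ratio (1/2) n ^ 3)"

definition fps_elliptic :: "real \<Rightarrow> real fps" where
  "fps_elliptic a = Abs_fps (\<lambda>n. pochhammer_ratio a n * pochhammer_ratio (1/2) n)"

lemma fps_elliptic_half: "fps_elliptic (1/2) = fps_2F1 (1/2)"
  by (simp add: fps_elliptic_def fps_2F1_def power2_eq_square)

lemma fps_conv_radius_2F1:
  assumes "\<bar>a\<bar> \<le> 1"
  shows "fps_conv_radius (fps_2F1 a) \<ge> 1"
proof (rule fps_conv_radius_ge_1)
  show "\<bar>fps_nth (fps_2F1 a) n\<bar> \<le> 1" for n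
    using abs_pochhammer_ratio_le_1[OF assms, of n]
    by (simp add: fps_2F1_def abs_square_le_1)
qed

lemma fps_conv_radius_elliptic:
  assumes "\<bar>a\<bar> \<le> 1"
  shows "fps_conv_radius (fps_elliptic a) \<ge> 1"
proof (rule fps_conv_radius_ge_1)
  show "\<bar>fps_nth (fps_elliptic a) n\<bar> \<le> 1" for n
    using mult_mono[OF abs_pochhammer_ratio_le_1[OF assms, of n]
        abs_pochhammer_ratio_le_1[of "1/2" n]]
    by (simp add: fps_elliptic_def abs_mult)
qed

text \<open>The hypergeometric equation theta^2 F = x (theta + a)^2 F. On coefficients it reads
  (m+1)^2 c_(m+1) = (a+m)^2 c_m.\<close>

lemma theta_2F1:
  "fps_theta (fps_theta (fps_2F1 a)) =
     fps_X * (fps_theta (fps_theta (fps_2F1 a)) + fps_const (2 * a) * fps_theta (fps_2F1 a)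
              + fps_const (a^2) * fps_2F1 a)"
proof (rule fps_ext)
  fix n
  show "fps_nth (fps_theta (fps_theta (fps_2F1 a))) n =
     fps_nth (fps_X * (fps_theta (fps_theta (fps_2F1 a)) + fps_const (2 * a) * fps_theta (fps_2F1 a)
              + fps_const (a^2) * fps_2F1 a)) n"
  proof (cases n)
    case (Suc m)
    have "real (Suc m) * (real (Suc m) * pochhammer_ratio a (Suc m) ^ 2) =
          ((a + real m) * pochhammer_ratio a m) ^ 2"
      unfolding pochhammer_ratio_Suc[symmetric] by (simp add: power2_eq_square algebra_simps)
    then show ?thesis
      by (simp add: Suc fps_2F1_def power2_eq_square algebra_simps del: of_nat_Suc)
  qed simp
qed

text \<open>The second order equation for y makes h = y^2 satisfy theta^3 h = x (theta + 1/2)^3 h.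
  Its coefficients obey the recurrence of the 3F2, and both series start with 1.\<close>

lemma clausen_square: "fps_2F1 (1/4) * fps_2F1 (1/4) = fps_3F2"
proof -
  define y where "y = fps_2F1 (1/4)"
  define y1 where "y1 = fps_theta y"
  define y2 where "y2 = fps_theta y1"
  define y3 where "y3 = fps_theta y2"
  define h where "h = y * y"
  have e2: "y2 = fps_X * (y2 + fps_const (1/2) * y1 + fps_const (1/16) * y)"
    using theta_2F1[of "1/4"] by (simp add: y_def y1_def y2_def power2_eq_square)
  have e3: "y3 = fps_X * (y2 + fps_const (1/2) * y1 + fps_const (1/16) * y)
               + fps_X * (y3 + fps_const (1/2) * y2 + fps_const (1/16) * y1)"
    using arg_cong[OF e2, of fps_theta]
    by (simp add: fps_theta_mult fps_theta_add fps_theta_X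
        flip: y1_def y2_def y3_def)
  have h1: "fps_theta h = 2 * (y * y1)"
    by (simp add: h_def fps_theta_mult flip: y1_def)
  have h2: "fps_theta (fps_theta h) = 2 * (y1 * y1) + 2 * (y * y2)"
    unfolding h1 by (simp add: fps_theta_mult fps_theta_add algebra_simps flip: y1_def y2_def)
  have h3: "fps_theta (fps_theta (fps_theta h)) = 6 * (y1 * y2) + 2 * (y * y3)"
    unfolding h2
    by (simp add: fps_theta_mult fps_theta_add algebra_simps flip: y1_def y2_def y3_def)
  \<comment> \<open>Every rational constant is rewritten as an integer multiple of 1/16, so that
    \<open>algebra\<close> meets a single unknown \<open>q\<close> with 16 q = 1.\<close>
  have c: "fps_const (1/2) = (2::real fps) * fps_const (1/4)"
     "fps_const (1/4) = (4::real fps) * fps_const (1/16)"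
     "fps_const (3/2) = (24::real fps) * fps_const (1/16)"
     "fps_const (3/4) = (12::real fps) * fps_const (1/16)"
     "fps_const (1/8) = (2::real fps) * fps_const (1/16)"
     "(16::real fps) * fps_const (1/16) = 1"
    by (simp_all flip: numeral_fps_const)
  define q :: "real fps" where "q = fps_const (1/16)"
  have q: "16 * q = 1" using c by (simp add: q_def)
  have main: "fps_theta (fps_theta (fps_theta h)) =
      fps_X * (fps_theta (fps_theta (fps_theta h)) + fps_const (3/2) * fps_theta (fps_theta h)
              + fps_const (3/4) * fps_theta h + fps_const (1/8) * h)"
    using e2 e3 q unfolding h3 unfolding h2 unfolding h1 unfolding h_def c q_def[symmetric] by algebra
  have rec: "real (Suc n) ^ 3 * fps_nth h (Suc n) = (1/2 + real n) ^ 3 * fps_nth h n" for n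
    using arg_cong[OF main, of "\<lambda>F. fps_nth F (Suc n)"]
    by (simp add: power3_eq_cube algebra_simps del: of_nat_Suc)
  have "fps_nth h n = pochhammer_ratio (1/2) n ^ 3" for n
  proof (induction n)
    case 0
    show ?case by (simp add: h_def y_def fps_2F1_def)
  next
    case (Suc n)
    have "real (Suc n) ^ 3 * fps_nth h (Suc n) = ((1/2 + real n) * pochhammer_ratio (1/2) n) ^ 3"
      using rec[of n] Suc by (simp add: power_mult_distrib)
    also have "\<dots> = real (Suc n) ^ 3 * pochhammer_ratio (1/2) (Suc n) ^ 3"
      unfolding pochhammer_ratio_Suc[symmetric] by (simp add: power_mult_distrib)
    finally show ?case by (simp del: of_nat_Suc)
  qed
  then show ?thesis
    by (intro fps_ext) (simp add: fps_3F2_def h_def y_def)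
qed

text \<open>The classical dK/dk = (E - k'^2 K)/(k k'^2), written in x = k^2 and cleared of
  denominators: 2x(1-x) dK/dx = E - (1-x)K.\<close>

lemma theta_elliptic_K:
  "fps_const 2 * fps_theta (fps_2F1 (1/2)) - fps_X * (fps_const 2 * fps_theta (fps_2F1 (1/2))) =
     fps_elliptic (-1/2) - fps_2F1 (1/2) + fps_X * fps_2F1 (1/2)"
proof (rule fps_ext)
  fix n
  show "fps_nth (fps_const 2 * fps_theta (fps_2F1 (1/2))
            - fps_X * (fps_const 2 * fps_theta (fps_2F1 (1/2)))) n =
     fps_nth (fps_elliptic (-1/2) - fps_2F1 (1/2) + fps_X * fps_2F1 (1/2)) n"
  proof (cases n)
    case 0
    then show ?thesis by (simp add: fps_elliptic_def fps_2F1_def)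
  next
    case (Suc m)
    define c where "c = pochhammer_ratio (1/2) m"
    define d where "d = pochhammer_ratio (1/2) (Suc m)"
    define e where "e = pochhammer_ratio (-1/2) (Suc m)"
    have 1: "d * (real m + 1) = (1/2 + real m) * c"
      using pochhammer_ratio_Suc[of "1/2" m] by (simp add: c_def d_def add.commute)
    \<comment> \<open>The coefficients of K at m and m+1 both become multiples of the one number
      \<open>e\<close>, which leaves a polynomial identity in m times \<open>e^2\<close>.\<close>
    have 2: "d = - (2 * real m + 1) * e"
      using pochhammer_ratio_plus_one[of "-1/2" "Suc m"] by (simp add: d_def e_def field_simps)
    have 3: "c = - 2 * (real m + 1) * e"
    proof -
      have "(1/2 + real m) * c = (1/2 + real m) * (- 2 * (real m + 1) * e)"
        using 1 2 by (simp add: algebra_simps)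
      moreover have "1/2 + real m \<noteq> 0" by linarith
      ultimately show ?thesis by (simp only: mult_cancel_left) simp
    qed
    have "2 * ((real m + 1) * d^2) - 2 * (real m * c^2) = e * d - d^2 + c^2"
      unfolding 2 3 by (simp add: power2_eq_square algebra_simps)
    then show ?thesis
      by (simp add: Suc fps_elliptic_def fps_2F1_def c_def d_def e_def algebra_simps)
  qed
qed

text \<open>The classical dE/dk = (E - K)/k in the variable x = k^2.\<close>

lemma theta_elliptic_E:
  "fps_const 2 * fps_theta (fps_elliptic (-1/2)) = fps_elliptic (-1/2) - fps_2F1 (1/2)"
proof (rule fps_ext)
  fix n
  define c where "c = pochhammer_ratio (1/2) n"
  define e where "e = pochhammer_ratio (-1/2) n"
  have 1: "c = (1 - 2 * real n) * e"
    using pochhammer_ratio_plus_one[of "-1/2" n] by (simp add: c_def e_def field_simps)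
  have "2 * (real n * (e * c)) = e * c - c^2"
    unfolding 1 by (simp add: power2_eq_square algebra_simps)
  then show "fps_nth (fps_const 2 * fps_theta (fps_elliptic (-1/2))) n =
      fps_nth (fps_elliptic (-1/2) - fps_2F1 (1/2)) n"
    by (simp add: fps_elliptic_def fps_2F1_def c_def e_def)
qed


section \<open>Real functions defined by the series\<close>

lemma fps_conv_radius_ge_1_deriv:
  fixes F :: "real fps"
  shows "fps_conv_radius F \<ge> 1 \<Longrightarrow> fps_conv_radius (fps_deriv F) \<ge> 1"
  using fps_conv_radius_deriv[of F] by (rule order_trans[rotated])

lemma fps_conv_radius_ge_1_mult:
  fixes F G :: "real fps"
  assumes "fps_conv_radius F \<ge> 1" "fps_conv_radius G \<ge> 1"
  shows "fps_conv_radius (F * G) \<ge> 1"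
proof -
  have "1 \<le> min (fps_conv_radius F) (fps_conv_radius G)" using assms by simp
  then show ?thesis using fps_conv_radius_mult by (rule order_trans)
qed

lemma fps_conv_radius_ge_1_add:
  fixes F G :: "real fps"
  assumes "fps_conv_radius F \<ge> 1" "fps_conv_radius G \<ge> 1"
  shows "fps_conv_radius (F + G) \<ge> 1"
proof -
  have "1 \<le> min (fps_conv_radius F) (fps_conv_radius G)" using assms by simp
  then show ?thesis using fps_conv_radius_add by (rule order_trans)
qed

lemma fps_conv_radius_ge_1_diff:
  fixes F G :: "real fps"
  assumes "fps_conv_radius F \<ge> 1" "fps_conv_radius G \<ge> 1"
  shows "fps_conv_radius (F - G) \<ge> 1"
proof -
  have "1 \<le> min (fps_conv_radius F) (fps_conv_radius G)" using assms by simp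
  then show ?thesis using fps_conv_radius_diff by (rule order_trans)
qed

lemmas fps_conv_radius_ge_1_intros =
  fps_conv_radius_ge_1_deriv fps_conv_radius_ge_1_mult fps_conv_radius_ge_1_add
  fps_conv_radius_ge_1_diff fps_conv_radius_theta

lemma eval_fps_simps:
  fixes F G :: "real fps"
  assumes "\<bar>x\<bar> < 1" "fps_conv_radius F \<ge> 1" "fps_conv_radius G \<ge> 1"
  shows "eval_fps (F + G) x = eval_fps F x + eval_fps G x"
    and "eval_fps (F - G) x = eval_fps F x - eval_fps G x"
    and "eval_fps (F * G) x = eval_fps F x * eval_fps G x"
  using less_fps_conv_radius[OF assms(2,1)] less_fps_conv_radius[OF assms(3,1)]
  by (rule eval_fps_add eval_fps_diff eval_fps_mult)+

lemma has_real_derivative_eval_fps: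
  assumes "fps_conv_radius F \<ge> 1" "\<bar>x::real\<bar> < 1"
  shows "(eval_fps F has_real_derivative eval_fps (fps_deriv F) x) (at x)"
  by (rule has_field_derivative_eval_fps) (rule less_fps_conv_radius[OF assms])

text \<open>The d/dx form of \<open>theta_2F1\<close>: expand theta^2 = x d/dx + x^2 d^2/dx^2 and
  cancel one factor x, which requires x to be nonzero.\<close>

lemma eval_2F1_ode:
  assumes "\<bar>a\<bar> \<le> 1" "0 < x" "x < 1"
  shows "x * (1 - x) * eval_fps (fps_deriv (fps_deriv (fps_2F1 a))) x
           + (1 - (2 * a + 1) * x) * eval_fps (fps_deriv (fps_2F1 a)) x
         = a^2 * eval_fps (fps_2F1 a) x"
proof -
  define F where "F = fps_2F1 a"
  have F: "fps_conv_radius F \<ge> 1" unfolding F_def using assms(1) by (rule fps_conv_radius_2F1)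
  note rad = F fps_conv_radius_ge_1_intros
  have x: "\<bar>x\<bar> < 1" using assms by simp
  have t1: "eval_fps (fps_theta F) x = x * eval_fps (fps_deriv F) x"
    by (intro eval_fps_theta F x)
  have t2: "eval_fps (fps_theta (fps_theta F)) x
      = x * (eval_fps (fps_deriv F) x + x * eval_fps (fps_deriv (fps_deriv F)) x)"
  proof -
    have "fps_deriv (fps_theta F) = fps_deriv F + fps_X * fps_deriv (fps_deriv F)"
      by (simp add: fps_theta_def)
    then have "eval_fps (fps_deriv (fps_theta F)) x
        = eval_fps (fps_deriv F) x + x * eval_fps (fps_deriv (fps_deriv F)) x"
      using x by (simp add: eval_fps_simps rad)
    then show ?thesis by (simp add: eval_fps_theta x rad)
  qed
  have "eval_fps (fps_theta (fps_theta F)) x = x * (eval_fps (fps_theta (fps_theta F)) x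
      + 2 * a * eval_fps (fps_theta F) x + a^2 * eval_fps F x)"
    using arg_cong[OF theta_2F1[of a], of "\<lambda>G. eval_fps G x"] x
    by (simp add: eval_fps_simps rad flip: F_def)
  then have "x * (eval_fps (fps_deriv F) x + x * eval_fps (fps_deriv (fps_deriv F)) x) =
      x * (x * (eval_fps (fps_deriv F) x + x * eval_fps (fps_deriv (fps_deriv F)) x)
        + 2 * a * (x * eval_fps (fps_deriv F) x) + a^2 * eval_fps F x)"
    unfolding t1 t2 .
  then have "eval_fps (fps_deriv F) x + x * eval_fps (fps_deriv (fps_deriv F)) x =
      x * (eval_fps (fps_deriv F) x + x * eval_fps (fps_deriv (fps_deriv F)) x)
        + 2 * a * (x * eval_fps (fps_deriv F) x) + a^2 * eval_fps F x"
    using assms(2) mult_left_cancel by (metis less_irrefl)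
  then show ?thesis
    unfolding F_def[symmetric] by (simp add: algebra_simps)
qed

section \<open>The substitution z = 4x(1-x)\<close>

lemma eval_fps_pos:
  assumes "fps_conv_radius F \<ge> 1" "0 \<le> x" "x < 1" "fps_nth F 0 > 0" "\<And>n. fps_nth F n \<ge> 0"
  shows "eval_fps F x > (0::real)"
  unfolding eval_fps_def
proof (rule suminf_pos2[where i = 0])
  show "summable (\<lambda>n. fps_nth F n * x ^ n)"
    by (rule summable_fps, rule less_fps_conv_radius) (use assms in auto)
qed (use assms in auto)

lemma modulus_quadratic_bounds:
  fixes x :: real
  assumes "0 < x" "x < 1/2"
  shows "0 < 4 * x * (1 - x)" "4 * x * (1 - x) < 1"
proof -
  have "1 - 4 * x * (1 - x) = (1 - 2 * x)^2"
    by (simp add: power2_eq_square algebra_simps)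
  moreover have "(1 - 2 * x)^2 > 0" using assms by simp
  ultimately show "4 * x * (1 - x) < 1" by linarith
qed (use assms in auto)

text \<open>Both sides of the quadratic transformation solve the same second order equation and are
  regular at the singular point 0, so \<open>x (1 - x)\<close> times their Wronskian is constant and vanishes
  at 0.\<close>

lemma quadratic_transformation:
  assumes "0 < t" "t < (1/2::real)"
  shows "eval_fps (fps_2F1 (1/4)) (4 * t * (1 - t)) = eval_fps (fps_2F1 (1/2)) t"
proof -
  define F where "F = fps_2F1 (1/2)"
  define G where "G = fps_2F1 (1/4)"
  have F: "fps_conv_radius F \<ge> 1" and G: "fps_conv_radius G \<ge> 1"
    by (simp_all add: F_def G_def fps_conv_radius_2F1)
  note rad = F G fps_conv_radius_ge_1_intros
  define f where "f = eval_fps F"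
  define f1 where "f1 = eval_fps (fps_deriv F)"
  define f2 where "f2 = eval_fps (fps_deriv (fps_deriv F))"
  define z where "z = (\<lambda>x::real. 4 * x * (1 - x))"
  define g where "g = eval_fps G"
  define g1 where "g1 = eval_fps (fps_deriv G)"
  define g2 where "g2 = eval_fps (fps_deriv (fps_deriv G))"
  define W where "W = (\<lambda>x. x * (1 - x) * (f x * (g1 (z x) * (4 * (1 - 2 * x))) - f1 x * g (z x)))"
  have z: "\<bar>z x\<bar> < 1" if "0 \<le> x" "x \<le> t" for x
    using modulus_quadratic_bounds[of x] that assms by (cases "x = 0") (auto simp: z_def)
  have df: "(f has_real_derivative f1 x) (at x)" "(f1 has_real_derivative f2 x) (at x)"
    if "0 \<le> x" "x \<le> t" for x
    unfolding f_def f1_def f2_def using that assms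
    by (auto intro!: has_real_derivative_eval_fps rad)
  have dz: "(z has_real_derivative 4 * (1 - 2 * x)) (at x)" for x
    unfolding z_def by (auto intro!: derivative_eq_intros simp: algebra_simps)
  have dg: "((\<lambda>x. g (z x)) has_real_derivative g1 (z x) * (4 * (1 - 2 * x))) (at x)"
    "((\<lambda>x. g1 (z x)) has_real_derivative g2 (z x) * (4 * (1 - 2 * x))) (at x)"
    if "0 \<le> x" "x \<le> t" for x
    unfolding g_def g1_def g2_def
    by (rule DERIV_chain2[OF has_real_derivative_eval_fps dz]; use z[OF that] in \<open>simp add: rad\<close>)+
  define D where "D = (\<lambda>x. (1 - 2 * x) * (f x * (g1 (z x) * (4 * (1 - 2 * x))) - f1 x * g (z x))
      + x * (1 - x) * (f x * (g2 (z x) * (4 * (1 - 2 * x))^2 - 8 * g1 (z x)) - f2 x * g (z x)))"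
  have dW: "(W has_real_derivative D x) (at x)" if "0 \<le> x" "x \<le> t" for x
    unfolding W_def D_def
    by (rule derivative_eq_intros df dg that refl)+
       (simp add: power2_eq_square algebra_simps)
  have D0: "D x = 0" if "0 < x" "x < t" for x
  proof -
    have x: "0 < x" "x < 1/2" using that assms by auto
    have 1: "x * (1 - x) * f2 x + (1 - 2 * x) * f1 x = (1/4) * f x"
      using eval_2F1_ode[of "1/2" x] x
      by (simp add: power2_eq_square flip: F_def) (simp flip: f_def f1_def f2_def)
    have 2: "z x * (1 - z x) * g2 (z x) + (1 - 3/2 * z x) * g1 (z x) = (1/16) * g (z x)"
      using eval_2F1_ode[of "1/4" "z x"] modulus_quadratic_bounds[OF x]
      by (simp add: z_def power2_eq_square flip: G_def) (simp flip: z_def g_def g1_def g2_def)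
    \<comment> \<open>Here z'^2 x(1-x) = 4z(1-z), so the equation of g in z, multiplied by 4,
      becomes an equation in x. The right-hand sides cancel because 4 * (1/16) = 1/4.\<close>
    have "D x = f x * (4 * (z x * (1 - z x) * g2 (z x) + (1 - 3/2 * z x) * g1 (z x)))
        - g (z x) * (x * (1 - x) * f2 x + (1 - 2 * x) * f1 x)"
      unfolding D_def z_def by (simp add: power2_eq_square algebra_simps)
    then show ?thesis unfolding 1 2 by simp
  qed
  have W0: "W x = 0" if "0 < x" "x < t" for x
  proof -
    have "W x = W 0"
    proof (rule DERIV_isconst2[of 0 t])
      show "continuous_on {0..t} W"
        by (intro DERIV_atLeastAtMost_imp_continuous_on) (use dW in auto)
      show "(W has_real_derivative 0) (at y)" if "0 < y" "y < t" for y
        using dW[of y] D0[of y] that by simp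
    qed (use that assms in auto)
    then show ?thesis by (simp add: W_def)
  qed
  have fpos: "f x > 0" if "0 \<le> x" "x \<le> t" for x
    unfolding f_def using that assms F by (intro eval_fps_pos) (auto simp: F_def fps_2F1_def)
  \<comment> \<open>The vanishing Wronskian is the numerator of the derivative of this quotient, and
    f > 0 keeps the quotient defined. It is therefore constant, with value 1 at 0.\<close>
  define Q where "Q = (\<lambda>x. g (z x) / f x)"
  have dQ: "(Q has_real_derivative
      (g1 (z x) * (4 * (1 - 2 * x)) * f x - g (z x) * f1 x) / (f x * f x)) (at x)"
    if "0 \<le> x" "x \<le> t" for x
    unfolding Q_def by (rule DERIV_divide df dg that)+ (use fpos[OF that] in simp)
  have "Q t = Q 0"
  proof (rule DERIV_isconst2[of 0 t])
    show "continuous_on {0..t} Q"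
      by (intro DERIV_atLeastAtMost_imp_continuous_on) (use dQ in auto)
    show "(Q has_real_derivative 0) (at y)" if y: "0 < y" "y < t" for y
    proof -
      have "f y * (g1 (z y) * (4 * (1 - 2 * y))) - f1 y * g (z y) = 0"
        using W0[OF y] y assms by (simp add: W_def)
      then show ?thesis using dQ[of y] y by (simp add: mult_ac)
    qed
  qed (use assms in auto)
  also have "Q 0 = 1"
    by (simp add: Q_def z_def f_def g_def F_def G_def eval_fps_at_0 fps_2F1_def)
  finally have "g (z t) = f t"
    using fpos[of t] assms by (simp add: Q_def)
  then show ?thesis by (simp add: g_def f_def z_def F_def G_def)
qed

text \<open>For z = 4x(1-x) the chain rule gives z d/dz = x(1-x)/(1-2x) d/dx. A closed form in x can
  thus be differentiated repeatedly without inverting the substitution.\<close>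

lemma eval_fps_theta_pullback:
  assumes F: "fps_conv_radius F \<ge> 1"
    and eq: "\<And>y. 0 < y \<Longrightarrow> y < 1/2 \<Longrightarrow> eval_fps F (4 * y * (1 - y)) = \<phi> y"
    and d: "(\<phi> has_real_derivative D) (at x)"
    and x: "0 < x" "x < 1/2"
  shows "eval_fps (fps_theta F) (4 * x * (1 - x)) = x * (1 - x) / (1 - 2 * x) * D"
proof -
  let ?z = "4 * x * (1 - x)"
  have z: "\<bar>?z\<bar> < 1" using modulus_quadratic_bounds[OF x] by simp
  have dz: "((\<lambda>x::real. 4 * x * (1 - x)) has_real_derivative 4 * (1 - 2 * x)) (at x)"
    by (auto intro!: derivative_eq_intros simp: algebra_simps)
  have "((\<lambda>x. eval_fps F (4 * x * (1 - x))) has_real_derivative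
      eval_fps (fps_deriv F) ?z * (4 * (1 - 2 * x))) (at x)"
    by (rule DERIV_chain2[OF has_real_derivative_eval_fps[OF F z] dz])
  moreover have "((\<lambda>x. eval_fps F (4 * x * (1 - x))) has_real_derivative D) (at x)"
    \<comment> \<open>The closed form is known on the open interval (0,1/2) alone, which is enough
      for a derivative at an interior point.\<close>
    by (rule has_field_derivative_transform_within_open[OF d, of "{0<..<1/2}"])
       (use x eq in auto)
  ultimately have "eval_fps (fps_deriv F) ?z * (4 * (1 - 2 * x)) = D"
    by (rule DERIV_unique)
  then have "D / (4 * (1 - 2 * x)) = eval_fps (fps_deriv F) ?z"
    using x by (auto simp del: distrib_left_numeral right_diff_distrib_numeral)
  then have "eval_fps (fps_theta F) ?z = ?z * (D / (4 * (1 - 2 * x)))"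
    using eval_fps_theta[OF F z] by simp
  also have "\<dots> = x * (1 - x) / (1 - 2 * x) * D"
    using x by (simp add: divide_simps)
  finally show ?thesis .
qed


section \<open>Complete elliptic integrals\<close>

text \<open>Wallis' integral. Differentiating - cos t sin^(2n+1) t, which vanishes at both
  endpoints, gives (2n+2) I_(n+1) = (2n+1) I_n.\<close>

lemma has_integral_sin_power_even:
  "((\<lambda>t. sin t ^ (2 * n)) has_integral pi/2 * pochhammer_ratio (1/2) n) {0..pi/2}"
proof (induction n)
  case 0
  show ?case using has_integral_const_real[of "1::real" 0 "pi/2"] by simp
next
  case (Suc n)
  have "((\<lambda>t. (2 * real n + 2) * sin t ^ (2 * Suc n) - (2 * real n + 1) * sin t ^ (2 * n))
      has_integral (- cos (pi/2) * sin (pi/2) ^ (2 * n + 1) - - cos 0 * sin 0 ^ (2 * n + 1)))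
      {0..pi/2}"
  proof (rule fundamental_theorem_of_calculus)
    fix t :: real
    have "((\<lambda>t. - cos t * sin t ^ (2 * n + 1)) has_real_derivative
        sin t * sin t ^ (2 * n + 1) - cos t * ((2 * real n + 1) * (cos t * sin t ^ (2 * n)))) (at t)"
      using DERIV_mult[OF DERIV_minus[OF DERIV_cos] DERIV_power[OF DERIV_sin], of "2 * n + 1" t]
      by (simp add: algebra_simps)
    also have "sin t * sin t ^ (2 * n + 1) - cos t * ((2 * real n + 1) * (cos t * sin t ^ (2 * n)))
        = sin t ^ (2 * Suc n) - (2 * real n + 1) * ((cos t)\<^sup>2 * sin t ^ (2 * n))"
      by (simp add: power2_eq_square algebra_simps)
    also have "\<dots> = (2 * real n + 2) * sin t ^ (2 * Suc n) - (2 * real n + 1) * sin t ^ (2 * n)"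
      unfolding cos_squared_eq by (simp add: power2_eq_square algebra_simps)
    finally show "((\<lambda>t. - cos t * sin t ^ (2 * n + 1)) has_vector_derivative
        (2 * real n + 2) * sin t ^ (2 * Suc n) - (2 * real n + 1) * sin t ^ (2 * n))
        (at t within {0..pi/2})"
      unfolding has_real_derivative_iff_has_vector_derivative[symmetric]
      by (rule has_field_derivative_at_within)
  qed simp
  then have "((\<lambda>t. (2 * real n + 2) * sin t ^ (2 * Suc n) - (2 * real n + 1) * sin t ^ (2 * n))
      has_integral 0) {0..pi/2}" by simp
  from has_integral_add[OF this has_integral_mult_right[OF Suc, of "2 * real n + 1"]]
  have "((\<lambda>t. (2 * real n + 2) * sin t ^ (2 * Suc n)) has_integral
      (2 * real n + 1) * (pi/2 * pochhammer_ratio (1/2) n)) {0..pi/2}" by simp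
  note * = has_integral_mult_right[OF this, of "1 / (2 * real n + 2)"]
  have "((\<lambda>t. sin t ^ (2 * Suc n)) has_integral
      (1 / (2 * real n + 2)) * ((2 * real n + 1) * (pi/2 * pochhammer_ratio (1/2) n))) {0..pi/2}"
  proof -
    have "1 / (2 * real n + 2) * ((2 * real n + 2) * y) = y" for y
      using of_nat_0_le_iff[of n, where ?'a = real] by (simp add: add_nonneg_eq_0_iff)
    then show ?thesis
      using * by (simp only:)
  qed
  also have "(1 / (2 * real n + 2)) * ((2 * real n + 1) * (pi/2 * pochhammer_ratio (1/2) n))
      = pi/2 * pochhammer_ratio (1/2) (Suc n)"
    unfolding pochhammer_ratio_Suc' by (simp add: divide_simps) (simp add: algebra_simps)
  finally show ?case .
qed

text \<open>Treats K (a = 1/2) and E (a = -1/2) together: expand the integrand by the binomial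
  series, integrate termwise with majorant |x|^n, and insert Wallis' integrals.\<close>

lemma has_integral_elliptic:
  assumes "\<bar>a\<bar> \<le> 1" "\<bar>x\<bar> < 1"
  shows "((\<lambda>t. (1 - x * (sin t)^2) powr (- a)) has_integral
      pi/2 * eval_fps (fps_elliptic a) x) {0..pi/2}"
proof -
  let ?u = "\<lambda>n t. pochhammer_ratio a n * (x * (sin t)^2) ^ n"
  have le: "\<bar>x * (sin t)^2\<bar> \<le> \<bar>x\<bar>" for t :: real
    using mult_left_mono[of "(sin t)^2" 1 "\<bar>x\<bar>"] by (simp add: abs_mult abs_square_le_1)
  have "uniform_limit {0..pi/2} (\<lambda>N t. \<Sum>n<N. ?u n t) (\<lambda>t. suminf (\<lambda>n. ?u n t)) sequentially"
  proof (rule Weierstrass_m_test)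
    show "summable (\<lambda>n. \<bar>x\<bar> ^ n)" using assms by (simp add: summable_geometric)
    show "norm (?u n t) \<le> \<bar>x\<bar> ^ n" for n t
    proof -
      have "\<bar>pochhammer_ratio a n\<bar> * \<bar>x * (sin t)^2\<bar> ^ n \<le> 1 * \<bar>x\<bar> ^ n"
        by (intro mult_mono power_mono le abs_pochhammer_ratio_le_1 assms) auto
      then show ?thesis by (simp add: abs_mult power_abs)
    qed
  qed
  moreover have "suminf (\<lambda>n. ?u n t) = (1 - x * (sin t)^2) powr (- a)" for t
    using le[of t] assms(2) by (intro sums_unique[symmetric] pochhammer_ratio_sums) linarith
  ultimately have "uniform_limit {0..pi/2} (\<lambda>N t. \<Sum>n<N. ?u n t)
      (\<lambda>t. (1 - x * (sin t)^2) powr (- a)) sequentially" by simp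
  then obtain I J where I: "\<And>N. ((\<lambda>t. \<Sum>n<N. ?u n t) has_integral I N) {0..pi/2}"
    and J: "((\<lambda>t. (1 - x * (sin t)^2) powr (- a)) has_integral J) {0..pi/2}"
    and lim: "I \<longlonglongrightarrow> J"
    by (rule uniform_limit_integral) (auto intro!: continuous_intros)
  have "I N = (\<Sum>n<N. pi/2 * (fps_nth (fps_elliptic a) n * x ^ n))" for N
  proof (rule has_integral_unique[OF I])
    have "(?u n has_integral pi/2 * (fps_nth (fps_elliptic a) n * x ^ n)) {0..pi/2}" for n
      using has_integral_mult_right[OF has_integral_sin_power_even[of n],
          of "pochhammer_ratio a n * x ^ n"]
      by (simp add: fps_elliptic_def power_mult_distrib mult_ac flip: power_mult)
    then show "((\<lambda>t. \<Sum>n<N. ?u n t) has_integral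
        (\<Sum>n<N. pi/2 * (fps_nth (fps_elliptic a) n * x ^ n))) {0..pi/2}"
      by (intro has_integral_sum) auto
  qed
  then have "(\<lambda>n. pi/2 * (fps_nth (fps_elliptic a) n * x ^ n)) sums J"
    using lim unfolding sums_def by presburger
  moreover have "(\<lambda>n. pi/2 * (fps_nth (fps_elliptic a) n * x ^ n)) sums
      (pi/2 * eval_fps (fps_elliptic a) x)"
    by (intro sums_mult sums_eval_fps less_fps_conv_radius fps_conv_radius_elliptic assms)
  ultimately show ?thesis using J sums_unique2 by blast
qed

lemma elliptic_integrand_pos:
  fixes k t :: real
  assumes "\<bar>k\<bar> < 1"
  shows "0 < 1 - k^2 * (sin t)^2"
proof -
  have "k^2 * (sin t)^2 \<le> k^2 * 1"
    by (intro mult_left_mono) (auto simp: abs_square_le_1)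
  moreover have "k^2 < 1" using assms by (simp add: abs_square_less_1)
  ultimately show ?thesis by linarith
qed

lemma ellK_has_integral:
  assumes "\<bar>k\<bar> < 1"
  shows "((\<lambda>t. 1 / sqrt (1 - k^2 * (sin t)^2)) has_integral
      pi/2 * eval_fps (fps_2F1 (1/2)) (k^2)) {0..pi/2}"
proof -
  have "((\<lambda>t. (1 - k^2 * (sin t)^2) powr (- (1/2))) has_integral
      pi/2 * eval_fps (fps_elliptic (1/2)) (k^2)) {0..pi/2}"
    using assms by (intro has_integral_elliptic) (auto simp: abs_square_less_1)
  moreover have "(1 - k^2 * (sin t)^2) powr (- (1/2)) = 1 / sqrt (1 - k^2 * (sin t)^2)" for t
    using elliptic_integrand_pos[OF assms, of t]
    by (simp add: powr_minus_divide powr_half_sqrt del: minus_divide_left)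
  ultimately show ?thesis by (simp add: fps_elliptic_half)
qed

lemma ellK_eq:
  assumes "\<bar>k\<bar> < 1"
  shows "ellK k = pi/2 * eval_fps (fps_2F1 (1/2)) (k^2)"
  unfolding ellK_def by (rule integral_unique[OF ellK_has_integral[OF assms]])

lemma ellE_eq:
  assumes "\<bar>k\<bar> < 1"
  shows "ellE k = pi/2 * eval_fps (fps_elliptic (-1/2)) (k^2)"
proof -
  have "((\<lambda>t. (1 - k^2 * (sin t)^2) powr (- (-1/2))) has_integral
      pi/2 * eval_fps (fps_elliptic (-1/2)) (k^2)) {0..pi/2}"
    using assms by (intro has_integral_elliptic) (auto simp: abs_square_less_1)
  moreover have "(1 - k^2 * (sin t)^2) powr (- (-1/2)) = sqrt (1 - k^2 * (sin t)^2)" for t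
    using elliptic_integrand_pos[OF assms, of t] by (simp add: powr_half_sqrt)
  ultimately show ?thesis unfolding ellE_def by (simp add: integral_unique)
qed

section \<open>Existence, uniqueness and location of the singular modulus\<close>

lemma ellK_strict_mono:
  assumes "0 \<le> v" "v < w" "w < 1"
  shows "ellK v < ellK w"
proof -
  let ?F = "fps_2F1 (1/2)"
  have F: "fps_conv_radius ?F \<ge> 1" by (simp add: fps_conv_radius_2F1)
  have w2: "w^2 < 1" using assms by (simp add: power_less_one_iff)
  have "eval_fps ?F (v^2) < eval_fps ?F (w^2)"
  proof (rule DERIV_pos_imp_increasing[of "v^2" "w^2" "eval_fps ?F"])
    show "v^2 < w^2" using assms by (intro power_strict_mono) auto
    fix y assume "v^2 \<le> y" "y \<le> w^2"
    then have y: "0 \<le> y" "y < 1" using w2 by (auto intro: order_trans[OF zero_le_power2])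
    have "eval_fps (fps_deriv ?F) y > 0"
      using y F pochhammer_ratio_pos[of "1/2" 1]
      by (intro eval_fps_pos fps_conv_radius_ge_1_deriv) (auto simp: fps_2F1_def)
    then show "\<exists>d. (eval_fps ?F has_real_derivative d) (at y) \<and> 0 < d"
      using has_real_derivative_eval_fps[OF F, of y] y by auto
  qed
  then show ?thesis using assms by (simp add: ellK_eq)
qed

lemma ellK_pos:
  assumes "\<bar>k\<bar> < 1"
  shows "ellK k > 0"
proof -
  have "k^2 < 1" using assms by (simp add: abs_square_less_1)
  then have "eval_fps (fps_2F1 (1/2)) (k^2) > 0"
    by (intro eval_fps_pos fps_conv_radius_2F1) (auto simp: fps_2F1_def)
  then show ?thesis using assms by (simp add: ellK_eq)
qed

lemma isCont_ellK:
  assumes "\<bar>k\<bar> < 1"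
  shows "isCont ellK k"
proof -
  have k2: "\<bar>k^2\<bar> < 1" using assms by (simp add: abs_square_less_1)
  have "isCont (eval_fps (fps_2F1 (1/2))) (k^2)"
    by (rule DERIV_isCont[OF has_real_derivative_eval_fps]) (use k2 in \<open>auto simp: fps_conv_radius_2F1\<close>)
  then have "isCont (\<lambda>k. eval_fps (fps_2F1 (1/2)) (k^2)) k"
    by (rule isCont_o2[where f = "\<lambda>k. k^2", rotated]) (intro isCont_power continuous_ident)
  then have cont: "isCont (\<lambda>k. pi/2 * eval_fps (fps_2F1 (1/2)) (k^2)) k"
    by (intro isCont_mult continuous_const)
  have eq: "\<forall>\<^sub>F k in nhds k. ellK k = pi/2 * eval_fps (fps_2F1 (1/2)) (k^2)"
  proof (rule eventually_mono)
    show "\<forall>\<^sub>F k in nhds k. k \<in> {-1<..<1}"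
      by (rule eventually_nhds_in_open) (use assms in auto)
  qed (auto simp: ellK_eq)
  show ?thesis using cont unfolding isCont_cong[OF eq] .
qed

text \<open>Shows that K(sqrt(1-w^2)) is unbounded as w -> 0, so that arbitrarily large r are
  reached. The radicand is cos^2 t + w^2 sin^2 t, and cos t = sin(pi/2 - t) <= pi/2 - t bounds it by
  (pi/2 - t + w)^2; the reciprocal of the root integrates to a logarithm.\<close>

lemma ellK_complementary_ge:
  assumes "0 < w" "w < 1"
  shows "ln (pi / 2 / w) \<le> ellK (sqrt (1 - w^2))"
proof -
  have w2: "0 < w^2" "w^2 < 1" using assms by (auto simp: power_less_one_iff)
  let ?k = "sqrt (1 - w^2)"
  have k: "\<bar>?k\<bar> < 1" using w2 by simp
  have k2: "?k^2 = 1 - w^2" using w2 by simp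
  have "((\<lambda>t. 1 / (pi/2 - t + w)) has_integral
      (- ln (pi/2 - pi/2 + w) - - ln (pi/2 - 0 + w))) {0..pi/2}"
  proof (rule fundamental_theorem_of_calculus)
    fix t :: real assume "t \<in> {0..pi/2}"
    then have "pi/2 - t + w > 0" using assms by auto
    then have "((\<lambda>t. - ln (pi/2 - t + w)) has_real_derivative - (1 / (pi/2 - t + w) * (0 - 1 + 0))) (at t)"
      by (intro DERIV_minus DERIV_chain2[OF DERIV_ln_divide] DERIV_add DERIV_diff DERIV_const DERIV_ident)
    then have "((\<lambda>t. - ln (pi/2 - t + w)) has_real_derivative 1 / (pi/2 - t + w)) (at t)"
      by simp
    then show "((\<lambda>t. - ln (pi/2 - t + w)) has_vector_derivative 1 / (pi/2 - t + w))
        (at t within {0..pi/2})"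
      unfolding has_real_derivative_iff_has_vector_derivative[symmetric]
      by (rule has_field_derivative_at_within)
  qed simp
  then have "((\<lambda>t. 1 / (pi/2 - t + w)) has_integral (- ln w + ln (pi/2 + w))) {0..pi/2}"
    by simp
  then have "- ln w + ln (pi/2 + w) \<le> pi/2 * eval_fps (fps_2F1 (1/2)) (?k^2)"
  proof (rule has_integral_le[OF _ ellK_has_integral[OF k]])
    fix t :: real assume t: "t \<in> {0..pi/2}"
    define u where "u = pi/2 - t"
    have u: "0 \<le> u" "u \<le> pi/2" using t by (auto simp: u_def)
    have "(cos t)^2 \<le> u^2"
      using u t sin_x_le_x[of u] sin_ge_zero[of u]
      by (intro power_mono) (auto simp: u_def sin_diff cos_ge_zero)
    moreover have "w^2 * (sin t)^2 \<le> w^2 * 1"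
      by (intro mult_left_mono) (auto simp: abs_square_le_1)
    moreover have "0 \<le> 2 * u * w" using u assms by simp
    moreover have "1 - ?k^2 * (sin t)^2 = (cos t)^2 + w^2 * (sin t)^2"
      unfolding k2 cos_squared_eq by (simp add: algebra_simps)
    ultimately have "1 - ?k^2 * (sin t)^2 \<le> (u + w)^2"
      by (simp add: power2_sum)
    then have "sqrt (1 - ?k^2 * (sin t)^2) \<le> u + w"
      using u assms by (intro real_le_lsqrt) auto
    then show "1 / (pi/2 - t + w) \<le> 1 / sqrt (1 - ?k^2 * (sin t)^2)"
      using elliptic_integrand_pos[OF k, of t] unfolding u_def
      by (intro frac_le) auto
  qed
  moreover have "ln (pi/2/w) \<le> - ln w + ln (pi/2 + w)"
  proof -
    have "ln (pi/2) \<le> ln (pi/2 + w)" using assms by (intro ln_mono) (auto simp: add_pos_pos)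
    moreover have "ln (pi/2/w) = ln (pi/2) - ln w" using assms by (intro ln_divide_pos) auto
    ultimately show ?thesis by linarith
  qed
  ultimately show ?thesis unfolding ellK_eq[OF k] by linarith
qed


text \<open>The quotient of complementary integrals decreases strictly, which gives uniqueness. At
  1/sqrt 2 modulus and complementary modulus coincide and the quotient is 1 < sqrt r, so the
  intermediate value theorem yields a solution below 1/sqrt 2.\<close>

lemma singular_modulus_bounds:
  assumes "r > 1"
  shows "0 < singular_modulus r" "singular_modulus r < 1" "(singular_modulus r)^2 < 1/2"
proof -
  define \<phi> where "\<phi> = (\<lambda>w. ellK (sqrt (1 - w^2)) / ellK w)"
  have compl: "0 < sqrt (1 - w^2)" "sqrt (1 - w^2) < 1" if "0 < w" "w < 1" for w :: real
    using that by (auto simp: power_less_one_iff)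
  have anti: "\<phi> w < \<phi> v" if "0 < v" "v < w" "w < 1" for v w
    unfolding \<phi>_def
  proof (rule frac_less)
    have "v^2 < w^2" using that by (intro power_strict_mono) auto
    then show "ellK (sqrt (1 - w^2)) < ellK (sqrt (1 - v^2))"
      using compl[of v] compl[of w] that by (intro ellK_strict_mono) auto
    show "0 \<le> ellK (sqrt (1 - w^2))"
      using compl[of w] that by (intro less_imp_le ellK_pos) auto
    show "0 < ellK v" using that by (intro ellK_pos) auto
    show "ellK v \<le> ellK w" using that by (intro less_imp_le ellK_strict_mono) auto
  qed
  have cont: "isCont \<phi> w" if "0 < w" "w < 1" for w
  proof -
    have "isCont (\<lambda>w. sqrt (1 - w^2)) w" by (intro continuous_intros)
    then have "isCont (\<lambda>w. ellK (sqrt (1 - w^2))) w"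
      by (rule isCont_o2) (use compl[OF that] in \<open>auto intro: isCont_ellK\<close>)
    moreover have "isCont ellK w" using that by (intro isCont_ellK) auto
    moreover have "ellK w > 0" using that by (intro ellK_pos) auto
    ultimately show ?thesis unfolding \<phi>_def by (intro isCont_divide) auto
  qed
  define s where "s = sqrt r"
  have s: "s > 1" using assms by (simp add: s_def)
  define h where "h = sqrt (1/2)"
  have h: "0 < h" "h < 1" "h^2 = 1/2" by (auto simp: h_def)
  have "sqrt (1 - h^2) = h" using h by (simp add: h_def)
  moreover define M where "M = ellK h"
  have M: "M > 0" unfolding M_def using h by (intro ellK_pos) auto
  ultimately have \<phi>h: "\<phi> h = 1" by (simp add: \<phi>_def M_def)
  \<comment> \<open>The exponential makes the logarithmic bound at \<open>w0\<close> at least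
    \<open>M * s\<close>. Since \<open>w0\<close> <= \<open>h\<close> also gives K(w0) <=
    \<open>M\<close>, the quotient at \<open>w0\<close> is at least \<open>s\<close>.\<close>
  define w0 where "w0 = min h (pi/2 * exp (- (M * s)))"
  have w0: "0 < w0" "w0 \<le> h" "w0 \<le> pi/2 * exp (- (M * s))" using h by (auto simp: w0_def)
  have "exp (M * s) \<le> pi/2/w0"
    using w0 by (simp add: exp_minus field_simps)
  then have "M * s \<le> ln (pi/2/w0)"
    using w0 by (subst ln_ge_iff) auto
  also have "\<dots> \<le> ellK (sqrt (1 - w0^2))"
    using w0 h by (intro ellK_complementary_ge) auto
  finally have 1: "M * s \<le> ellK (sqrt (1 - w0^2))" .
  have 2: "ellK w0 \<le> M"
    using w0 h ellK_strict_mono[of w0 h] by (cases "w0 = h") (auto simp: M_def)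
  have 3: "ellK w0 > 0" using w0 h by (intro ellK_pos) auto
  have "s * ellK w0 \<le> s * M" using 2 s by simp
  then have "s \<le> \<phi> w0"
    using 1 3 unfolding \<phi>_def by (simp add: le_divide_eq mult.commute)
  then obtain w where w: "w0 \<le> w" "w \<le> h" "\<phi> w = s"
    using IVT2[of \<phi> h s w0] \<phi>h s w0 h cont by (auto simp: le_less_trans less_le_trans)
  have w': "0 < w" "w < 1" "w < h"
    using w w0 h \<phi>h s by (auto simp: less_le)
  have "singular_modulus r = w"
    unfolding singular_modulus_def
  proof (rule the_equality)
    show "0 < w \<and> w < 1 \<and> ellK (sqrt (1 - w\<^sup>2)) / ellK w = sqrt r"
      using w w' by (simp add: \<phi>_def s_def)
    fix v assume "0 < v \<and> v < 1 \<and> ellK (sqrt (1 - v\<^sup>2)) / ellK v = sqrt r"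
    then have v: "0 < v" "v < 1" "\<phi> v = s" by (auto simp: \<phi>_def s_def)
    show "v = w"
      using anti[of v w] anti[of w v] v w w' by (cases v w rule: linorder_cases) auto
  qed
  moreover have "w^2 < h^2" using w' by (intro power_strict_mono) auto
  ultimately show "0 < singular_modulus r" "singular_modulus r < 1"
      "(singular_modulus r)^2 < 1/2"
    using w' h by simp_all
qed

section \<open>The series\<close>

lemma fps_conv_radius_3F2: "fps_conv_radius fps_3F2 \<ge> 1"
  unfolding clausen_square[symmetric]
  by (intro fps_conv_radius_ge_1_mult fps_conv_radius_2F1) auto

text \<open>Dividing by n! splits the binomial coefficient into 1/j! and 1/(n-j)!, which turns
  \<open>B3\<close> into a Cauchy product.\<close>

lemma fps_nth_3F2_square: "fps_nth (fps_3F2 * fps_3F2) n = B3 n / fact n ^ 3"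
proof -
  have "(real (n choose j) * pochhammer (1/2) j * pochhammer (1/2) (n - j)) ^ 3 / fact n ^ 3
      = pochhammer_ratio (1/2) j ^ 3 * pochhammer_ratio (1/2) (n - j) ^ 3" if "j \<le> n" for j
  proof -
    have "real (n choose j) * pochhammer (1/2) j * pochhammer (1/2) (n - j) / fact n
        = pochhammer_ratio (1/2) j * pochhammer_ratio (1/2) (n - j)"
      using that by (simp add: binomial_fact pochhammer_ratio_def)
    from arg_cong[OF this, of "\<lambda>u. u ^ 3"] show ?thesis
      by (simp add: power_divide power_mult_distrib)
  qed
  then show ?thesis
    by (simp add: fps_mult_nth fps_3F2_def B3_def sum_divide_distrib)
qed

lemma sums_quadratic_weight:
  assumes F: "fps_conv_radius F \<ge> 1" and z: "\<bar>z\<bar> < 1"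
  shows "(\<lambda>n. fps_nth F n * z ^ n * ((real n)^2 + \<beta> * real n + \<gamma>)) sums
    (eval_fps (fps_theta (fps_theta F)) z + \<beta> * eval_fps (fps_theta F) z + \<gamma> * eval_fps F z)"
proof -
  have "(\<lambda>n. fps_nth (fps_theta (fps_theta F)) n * z ^ n
        + \<beta> * (fps_nth (fps_theta F) n * z ^ n) + \<gamma> * (fps_nth F n * z ^ n)) sums
      (eval_fps (fps_theta (fps_theta F)) z + \<beta> * eval_fps (fps_theta F) z + \<gamma> * eval_fps F z)"
    by (intro sums_add sums_mult sums_eval_fps less_fps_conv_radius fps_conv_radius_theta F z)
  moreover have "fps_nth (fps_theta (fps_theta F)) n * z ^ n
        + \<beta> * (fps_nth (fps_theta F) n * z ^ n) + \<gamma> * (fps_nth F n * z ^ n)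
      = fps_nth F n * z ^ n * ((real n)^2 + \<beta> * real n + \<gamma>)" for n
    by (simp add: power2_eq_square algebra_simps)
  ultimately show ?thesis by simp
qed

lemma elliptic_series_derivatives:
  fixes x :: real
  assumes "0 < x" "x < 1"
  defines "f \<equiv> eval_fps (fps_2F1 (1/2))" and "e \<equiv> eval_fps (fps_elliptic (-1/2))"
  shows "(f has_real_derivative (e x - (1 - x) * f x) / (2 * x * (1 - x))) (at x)"
    and "(e has_real_derivative (e x - f x) / (2 * x)) (at x)"
proof -
  define F where "F = fps_2F1 (1/2)"
  define E where "E = fps_elliptic (-1/2)"
  have F: "fps_conv_radius F \<ge> 1" and E: "fps_conv_radius E \<ge> 1"
    by (simp_all add: F_def E_def fps_conv_radius_2F1 fps_conv_radius_elliptic)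
  note rad = F E fps_conv_radius_ge_1_intros
  have x: "\<bar>x\<bar> < 1" using assms by simp
  have "2 * (x * eval_fps (fps_deriv F) x) - x * (2 * (x * eval_fps (fps_deriv F) x))
      = e x - f x + x * f x"
    using arg_cong[OF theta_elliptic_K[folded F_def E_def], of "\<lambda>G. eval_fps G x"] x
    unfolding f_def e_def F_def[symmetric] E_def[symmetric]
    by (simp add: eval_fps_simps eval_fps_theta rad)
  then have *: "eval_fps (fps_deriv F) x = (e x - (1 - x) * f x) / (2 * x * (1 - x))"
    using assms(1,2) by (simp add: field_simps)
  then show "(f has_real_derivative (e x - (1 - x) * f x) / (2 * x * (1 - x))) (at x)"
    using has_real_derivative_eval_fps[OF F x] unfolding * unfolding f_def F_def by simp
  have "2 * (x * eval_fps (fps_deriv E) x) = e x - f x"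
    using arg_cong[OF theta_elliptic_E[folded F_def E_def], of "\<lambda>G. eval_fps G x"] x
    unfolding f_def e_def F_def[symmetric] E_def[symmetric]
    by (simp add: eval_fps_simps eval_fps_theta rad)
  then have *: "eval_fps (fps_deriv E) x = (e x - f x) / (2 * x)"
    using assms(1) by (simp add: field_simps)
  then show "(e has_real_derivative (e x - f x) / (2 * x)) (at x)"
    using has_real_derivative_eval_fps[OF E x] unfolding * unfolding e_def E_def by simp
qed

text \<open>\<open>U\<close> is 2x(1-x) f'(x). The factor x(1-x) of the pullback cancels the
  denominators of f' and e', so only powers of 1-2x remain below the line.\<close>

lemma eval_3F2_square:
  fixes x :: real
  assumes x: "0 < x" "x < 1/2"
  defines "G \<equiv> fps_3F2 * fps_3F2" and "z \<equiv> 4 * x * (1 - x)"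
    and "f \<equiv> eval_fps (fps_2F1 (1/2)) x" and "e \<equiv> eval_fps (fps_elliptic (-1/2)) x"
  defines "U \<equiv> e - (1 - x) * f"
  shows "eval_fps G z = f ^ 4"
    and "eval_fps (fps_theta G) z = 2 * f ^ 3 * U / (1 - 2 * x)"
    and "eval_fps (fps_theta (fps_theta G)) z =
      ((3 * f^2 * U^2 + f^3 * ((1 - x) * (e - f) + 2 * x * (1 - x) * f - (1 - x) * U)) * (1 - 2 * x)
         + 4 * x * (1 - x) * f^3 * U) / (1 - 2 * x) ^ 3"
proof -
  define ff where "ff = eval_fps (fps_2F1 (1/2))"
  define ee where "ee = eval_fps (fps_elliptic (-1/2))"
  have G: "fps_conv_radius G \<ge> 1"
    unfolding G_def by (intro fps_conv_radius_ge_1_mult fps_conv_radius_3F2)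
  have 0: "eval_fps G (4 * y * (1 - y)) = ff y ^ 4" if "0 < y" "y < 1/2" for y
  proof -
    have z: "\<bar>4 * y * (1 - y)\<bar> < 1" using modulus_quadratic_bounds[OF that] by linarith
    have r: "fps_conv_radius (fps_2F1 (1/4)) \<ge> 1" by (simp add: fps_conv_radius_2F1)
    have "eval_fps G (4 * y * (1 - y)) = eval_fps (fps_2F1 (1/4)) (4 * y * (1 - y)) ^ 4"
      unfolding G_def clausen_square[symmetric]
        eval_fps_simps(3)[OF z fps_conv_radius_ge_1_mult[OF r r] fps_conv_radius_ge_1_mult[OF r r]]
        eval_fps_simps(3)[OF z r r]
      by (simp add: power4_eq_xxxx mult.assoc)
    then show ?thesis using quadratic_transformation[OF that] by (simp add: ff_def)
  qed
  have df: "(ff has_real_derivative (ee y - (1 - y) * ff y) / (2 * y * (1 - y))) (at y)"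
    and de: "(ee has_real_derivative (ee y - ff y) / (2 * y)) (at y)" if "0 < y" "y < 1/2" for y
    using elliptic_series_derivatives[of y] that by (simp_all add: ff_def ee_def)
  define P where "P = (\<lambda>y. 2 * ff y ^ 3 * (ee y - (1 - y) * ff y) / (1 - 2 * y))"
  have 1: "eval_fps (fps_theta G) (4 * y * (1 - y)) = P y" if y: "0 < y" "y < 1/2" for y
  proof -
    have "((\<lambda>y. ff y ^ 4) has_real_derivative
        4 * (ff y ^ 3 * ((ee y - (1 - y) * ff y) / (2 * y * (1 - y))))) (at y)"
      by (rule derivative_eq_intros df[OF y] refl)+ simp
    from eval_fps_theta_pullback[OF G 0 this y]
    show ?thesis using y unfolding P_def by (simp add: divide_simps)
  qed
  define f1 where "f1 = U / (2 * x * (1 - x))"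
  define e1 where "e1 = (e - f) / (2 * x)"
  define D where "D = ((6 * f^2 * f1 * U + 2 * f^3 * (e1 + f - (1 - x) * f1)) * (1 - 2 * x)
      + 4 * f^3 * U) / (1 - 2 * x)^2"
  have "(P has_real_derivative D) (at x)"
    unfolding P_def D_def f1_def e1_def U_def f_def e_def ff_def[symmetric] ee_def[symmetric]
    by (rule derivative_eq_intros df[OF x] de[OF x] refl)+
      (use x in \<open>simp_all add: power2_eq_square algebra_simps\<close>)
  from eval_fps_theta_pullback[OF fps_conv_radius_theta[OF G] 1 this x]
  have "eval_fps (fps_theta (fps_theta G)) z = x * (1 - x) / (1 - 2 * x) * D"
    by (simp add: z_def)
  \<comment> \<open>Regrouped so that x(1-x) f1 and x e1 occur as blocks, to be replaced by U/2 and
    (e-f)/2.\<close>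
  also have "\<dots> = ((6 * f^2 * (x * (1 - x) * f1) * U
       + 2 * f^3 * ((1 - x) * (x * e1) + x * (1 - x) * f - (1 - x) * (x * (1 - x) * f1))) * (1 - 2 * x)
       + 4 * x * (1 - x) * f^3 * U) / (1 - 2 * x)^3"
  proof -
    have eq: "x * (1 - x) / L * (M / L^2) = x * (1 - x) * M / L^3" for L M :: real
      by (simp add: eval_nat_numeral)
    show ?thesis
      unfolding D_def eq by (rule arg_cong[of _ _ "\<lambda>u. u / (1 - 2 * x)^3"])
        (simp add: algebra_simps)
  qed
  also have "x * (1 - x) * f1 = U / 2" using x unfolding f1_def by (simp add: divide_simps)
  also have "x * e1 = (e - f) / 2" using x by (simp add: e1_def)
  finally show "eval_fps (fps_theta (fps_theta G)) z =
      ((3 * f^2 * U^2 + f^3 * ((1 - x) * (e - f) + 2 * x * (1 - x) * f - (1 - x) * U)) * (1 - 2 * x)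
         + 4 * x * (1 - x) * f^3 * U) / (1 - 2 * x) ^ 3"
    by (rule trans, intro arg_cong[of _ _ "\<lambda>u. u / (1 - 2 * x)^3"])
      (simp add: power2_eq_square field_simps)
  show "eval_fps G z = f ^ 4" using 0[OF x] by (simp add: z_def f_def ff_def)
  show "eval_fps (fps_theta G) z = 2 * f ^ 3 * U / (1 - 2 * x)"
    using 1[OF x] by (simp add: z_def U_def f_def ff_def e_def ee_def P_def)
qed

theorem theorem2p3:
  fixes r :: real
  assumes "r > 1"
  defines "k \<equiv> singular_modulus r"
  defines "k' \<equiv> sqrt (1 - k^2)"
  defines "a \<equiv> elliptic_alpha r"
  defines "b \<equiv> (3 * a + sqrt r - 6 * a * k^2 - 9 * sqrt r * k^2 + 12 * sqrt r * k^4)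
                / (sqrt r * (1 - 2 * k^2)^2)"
  defines "c \<equiv> (3 * a^2 - 6 * a * sqrt r * k^2 - r * k^2 + 4 * r * k^4)
                / (r * (1 - 2 * k^2)^2)"
  shows "(\<lambda>n. B3 n / (fact n)^3 * (2 * k * k')^(2 * n)
              * ((real n)^2 + (b - 1) * real n + c))
         sums (3 / ((1 - 2 * k^2)^2 * r * pi^2))"
proof -
  define x where "x = k^2"
  have k: "0 < k" "k < 1" and x: "0 < x" "x < 1/2"
    using singular_modulus_bounds[OF assms(1)] by (auto simp: k_def x_def)
  define s where "s = sqrt r"
  have s: "s > 0" "s^2 = r" using assms(1) by (auto simp: s_def)
  define L where "L = 1 - 2 * x"
  have L: "L > 0" using x by (simp add: L_def)
  define f where "f = eval_fps (fps_2F1 (1/2)) x"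
  define e where "e = eval_fps (fps_elliptic (-1/2)) x"
  have K: "ellK k = pi/2 * f" and E: "ellE k = pi/2 * e"
    using ellK_eq[of k] ellE_eq[of k] k by (simp_all add: f_def e_def x_def)
  have f: "f > 0" using ellK_pos[of k] k K by (simp add: zero_less_mult_iff)
  \<comment> \<open>The definition of alpha is divided by sqrt r: \<open>p\<close> is its first term
    pi/(4 K^2) after this scaling, with K = pi f/2. The relation becomes e/f = 1 + p - A.\<close>
  define A where "A = a / s"
  define p where "p = 1 / (pi * s * f^2)"
  have "a = 1 / (pi * f^2) - s * (e / f - 1)"
    unfolding a_def elliptic_alpha_def Let_def k_def[symmetric] K E s_def
    by (simp add: power_mult_distrib power2_eq_square)
  then have "A = p - (e / f - 1)"
    using s by (simp add: A_def p_def diff_divide_distrib)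
  then have e: "e = f * (1 + p - A)" using f by (simp add: field_simps)
  define B where "B = 3 * A + 1 - 6 * A * x - 9 * x + 12 * x^2"
  define C where "C = 3 * A^2 - 6 * A * x - x + 4 * x^2"
  have aA: "a = A * s" using s by (simp add: A_def)
  have k4: "k^4 = x^2" by (simp add: x_def)
  have b: "b = B / L^2"
  proof -
    have "b = (s * B) / (s * L^2)"
      unfolding b_def k4 aA x_def[symmetric] s_def[symmetric] L_def[symmetric] B_def
      by (simp add: algebra_simps)
    then show ?thesis using s by simp
  qed
  have c: "c = C / L^2"
  proof -
    have "c = (s^2 * C) / (s^2 * L^2)"
      unfolding c_def k4 aA x_def[symmetric] s_def[symmetric] L_def[symmetric] C_def
      unfolding s(2)[symmetric]
      by (simp add: power2_eq_square algebra_simps)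
    then show ?thesis using s(1) by simp
  qed
  define z where "z = 4 * x * (1 - x)"
  have z: "\<bar>z\<bar> < 1" using modulus_quadratic_bounds[OF x] by (simp add: z_def)
  have zk: "(2 * k * k')^(2 * n) = z ^ n" for n
  proof -
    have "(2 * k * k')^2 = z"
      using x by (simp add: k'_def power_mult_distrib z_def flip: x_def)
    then show ?thesis by (simp add: power_mult)
  qed
  define G where "G = fps_3F2 * fps_3F2"
  have G: "fps_conv_radius G \<ge> 1"
    unfolding G_def by (intro fps_conv_radius_ge_1_mult fps_conv_radius_3F2)
  have U: "e - (1 - x) * f = f * (x + p - A)" unfolding e by (simp add: algebra_simps)
  have ef: "e - f = f * (p - A)" unfolding e by (simp add: algebra_simps)
  define V where "V = x + p - A"
  define W where "W = (3 * V^2 + ((1 - x) * (p - A) + 2 * x * (1 - x) - (1 - x) * V)) * L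
      + 4 * x * (1 - x) * V"
  have g0: "eval_fps G z = f^4"
    and g1: "eval_fps (fps_theta G) z = 2 * f^4 * V / L"
    and g2: "eval_fps (fps_theta (fps_theta G)) z = f^4 * W / L^3"
    using eval_3F2_square[OF x]
    unfolding G_def[symmetric] z_def[symmetric] f_def[symmetric] e_def[symmetric] U ef
      L_def[symmetric] V_def[symmetric] W_def
    by (simp_all add: power2_eq_square power3_eq_cube power4_eq_xxxx algebra_simps)
  \<comment> \<open>The left side is quadratic in \<open>p\<close>. The choice of \<open>B\<close>
    cancels the linear term and that of \<open>C\<close> the constant term, for every value of
    \<open>A\<close> and \<open>x\<close>; the remaining f^4 p^2 is independent of K because p is
    proportional to 1/f^2.\<close>
  have poly: "W + (B - L^2) * (2 * V) + C * L = 3 * p^2 * L"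
    unfolding W_def V_def B_def C_def L_def by (simp add: power2_eq_square algebra_simps)
  have "(\<lambda>n. fps_nth G n * z ^ n * ((real n)^2 + (b - 1) * real n + c)) sums
      (f^4 * W / L^3 + (b - 1) * (2 * f^4 * V / L) + c * f^4)"
    using sums_quadratic_weight[OF G z, of "b - 1" c] unfolding g0 g1 g2 .
  also have "f^4 * W / L^3 + (b - 1) * (2 * f^4 * V / L) + c * f^4
      = f^4 * (W + (B - L^2) * (2 * V) + C * L) / L^3"
  proof -
    have "(B / L^2 - 1) * (2 * f^4 * V / L) = f^4 * ((B - L^2) * (2 * V)) / L^3"
      using L by (simp add: diff_divide_distrib algebra_simps eval_nat_numeral)
    moreover have "C / L^2 * f^4 = f^4 * (C * L) / L^3"
      using L by (simp add: eval_nat_numeral)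
    ultimately show ?thesis
      unfolding b c by (simp add: add_divide_distrib distrib_left)
  qed
  also have "\<dots> = 3 * (f^2 * p)^2 / L^2"
    unfolding poly using L by (simp add: power2_eq_square power3_eq_cube power4_eq_xxxx)
  also have "f^2 * p = 1 / (pi * s)" using f by (simp add: p_def)
  also have "3 * (1 / (pi * s))^2 / L^2 = 3 / (L^2 * r * pi^2)"
    using s by (simp add: power_divide power_mult_distrib mult_ac)
  finally show ?thesis
    unfolding zk by (simp add: G_def fps_nth_3F2_square L_def x_def)
qed

end
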